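(* Let $\{s_n\}_{n\ge1}$ be a sequence of positive integers tending to infinity with $s_n\ge3$ for all $n\ge1$. Then for any positive number $N\ge2$, $$\dim\{x\in[0,1):s_n\le a_n(x)<Ns_n\ \ \forall n\ge1\}=\liminf_{n\to\infty}\frac{\log(s_1s_2\cdots s_n)}{2\log(s_1s_2\cdots s_n)+\log s_{n+1}}.$$
   Context: $a_n(x)$ denotes the $n$-th partial quotient of the continued fraction expansion of an irrational $x\in[0,1)$, and $\dim$ denotes Hausdorff dimension. *)

theory Defs
  imports "HOL-Analysis.Analysis"
begin

definition gauss_map :: "real \<Rightarrow> real" where
  "gauss_map x = frac (1 / x)"

text \<open>
  For irrational \<open>x \<in> [0,1)\<close> we have \<open>x = [0; a\<^sub>1, a\<^sub>2, \<dots>]\<close> with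
  \<open>a\<^sub>n = cf_quotient n x\<close> for \<open>n \<ge> 1\<close>. The value at \<open>n = 0\<close> and at rational \<open>x\<close> is
  not meaningful.
\<close>

definition cf_quotient :: "nat \<Rightarrow> real \<Rightarrow> int" where
  "cf_quotient n x = \<lfloor>1 / (gauss_map ^^ (n - 1)) x\<rfloor>"

text \<open>
  The gauge \<open>|U|\<^sup>t\<close> with the usual conventions \<open>0\<^sup>0 = 1\<close> for nonempty \<open>U\<close> and
  \<open>|\<emptyset>|\<^sup>t = 0\<close>; note that \<open>0 powr 0 = 0\<close> in the library.
\<close>

definition hausdorff_gauge :: "real \<Rightarrow> 'a::metric_space set \<Rightarrow> ennreal" where
  "hausdorff_gauge t U =
     (if U = {} then 0 else if t = 0 then 1 else ennreal (diameter U powr t))"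

text \<open>
  Boundedness is required explicitly because \<open>diameter\<close> is unspecified on unbounded sets.
  Finite covers are included by padding with empty sets.
\<close>

definition delta_covers :: "real \<Rightarrow> 'a::metric_space set \<Rightarrow> (nat \<Rightarrow> 'a set) set" where
  "delta_covers \<delta> E =
     {U. E \<subseteq> (\<Union>i. U i) \<and> (\<forall>i. bounded (U i) \<and> diameter (U i) \<le> \<delta>)}"

definition hausdorff_premeasure :: "real \<Rightarrow> real \<Rightarrow> 'a::metric_space set \<Rightarrow> ennreal" where
  "hausdorff_premeasure t \<delta> E = (INF U \<in> delta_covers \<delta> E. \<Sum>i. hausdorff_gauge t (U i))"

definition hausdorff_measure :: "real \<Rightarrow> 'a::metric_space set \<Rightarrow> ennreal" where
  "hausdorff_measure t E = (SUP \<delta> \<in> {0<..}. hausdorff_premeasure t \<delta> E)"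

definition hausdorff_dim :: "'a::metric_space set \<Rightarrow> ereal" where
  "hausdorff_dim E = Inf {ereal t | t. 0 \<le> t \<and> hausdorff_measure t E = 0}"

end

theory Submission
  imports Defs "HOL-Probability.Probability"
begin

text \<open>
  Write \<open>Q\<^sub>n\<close> for the product of the first \<open>n\<close> scales \<open>s\<^sub>1, \<dots>, s\<^sub>n\<close>. If \<open>x\<close> and \<open>y\<close> share their
  first quotient, then \<open>|x - y| = x y |T x - T y|\<close> for the Gauss map \<open>T\<close>; iterating this replaces
  the theory of convergents. It shows that the points of the set in one cylinder of order \<open>n\<close> have
  distance at most \<open>1 / (Q\<^sub>n\<^sup>2 s\<^sub>n\<^sub>+\<^sub>1)\<close>, and the at most \<open>N\<^sup>n Q\<^sub>n\<close> cylinders give the upper bound,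
  because \<open>Q\<^sub>n\<close> outgrows every \<open>K\<^sup>n\<close>.

  For the lower bound, choose the digits independently and uniformly in \<open>[s\<^sub>n, 2 s\<^sub>n)\<close>. Points whose
  digits first differ at position \<open>n + 1\<close>, by \<open>d\<close>, have distance at least
  \<open>d / (6 4\<^sup>n Q\<^sub>n\<^sub>+\<^sub>1\<^sup>2)\<close>. Hence a set of diameter at most \<open>r\<close> meets one cylinder of order \<open>n\<close>, for
  a suitable \<open>n\<close>, in few cylinders of order \<open>n + 1\<close>, and its mass is at most \<open>(12 r)\<^sup>t\<close>: the mass
  distribution principle applies. Covering sets are replaced by cylinders of digit sequences, so the
  coding map need not be measurable.
\<close>

section \<open>Orbits of the Gauss map\<close>

lemma cf_quotient_Suc: "cf_quotient (Suc k) x = \<lfloor>1 / (gauss_map ^^ k) x\<rfloor>"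
  by (simp add: cf_quotient_def)

lemma inverse_eq_quotient_plus_gauss_map:
  "1 / (gauss_map ^^ k) x = of_int (cf_quotient (Suc k) x) + (gauss_map ^^ Suc k) x"
  by (simp add: cf_quotient_Suc gauss_map_def frac_def)

section \<open>Rational and irrational orbits\<close>

lemma gauss_map_notin_Rats:
  assumes "x \<notin> \<rat>"
  shows "gauss_map x \<notin> \<rat>"
proof
  assume "gauss_map x \<in> \<rat>"
  then have "of_int \<lfloor>1 / x\<rfloor> + gauss_map x \<in> \<rat>"
    by simp
  then have "1 / x \<in> \<rat>"
    by (simp add: gauss_map_def frac_def)
  then have "1 / (1 / x) \<in> \<rat>"
    by (rule Rats_divide[OF Rats_1])
  with assms show False
    by simp
qed

lemma funpow_gauss_map_notin_Rats: "x \<notin> \<rat> \<Longrightarrow> (gauss_map ^^ n) x \<notin> \<rat>"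
  by (induction n) (auto simp: gauss_map_notin_Rats)

lemma funpow_gauss_map_bounds:
  assumes "x \<in> {0..<1}" "x \<notin> \<rat>"
  shows "0 < (gauss_map ^^ n) x \<and> (gauss_map ^^ n) x < 1"
proof -
  have "0 \<le> (gauss_map ^^ n) x \<and> (gauss_map ^^ n) x < 1"
    using assms(1) by (cases n) (auto simp: gauss_map_def frac_ge_0 frac_lt_1)
  moreover have "(gauss_map ^^ n) x \<noteq> 0"
    using funpow_gauss_map_notin_Rats[OF assms(2), of n] by (metis Rats_0)
  ultimately show ?thesis
    by simp
qed

text \<open>On \<open>p / q\<close> the Gauss map is one step of the Euclidean algorithm: it yields
  \<open>(q mod p) / p\<close>, whose denominator is smaller, so induction on \<open>q\<close>
  applies.\<close>

lemma rational_gauss_orbit_hits_zero: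
  fixes p q :: nat
  assumes "0 < p" "p < q"
  shows "\<exists>n. (gauss_map ^^ n) (real p / real q) = 0"
  using assms
proof (induction q arbitrary: p rule: less_induct)
  case (less q)
  have g: "gauss_map (real p / real q) = real (q mod p) / real p"
  proof -
    have "real q = real p * real (q div p) + real (q mod p)"
      unfolding of_nat_mult[symmetric] of_nat_add[symmetric] by simp
    then have "real q / real p - real (q mod p) / real p = of_int (int (q div p))"
      using less.prems by (simp add: field_simps)
    moreover have "0 \<le> real (q mod p) / real p" "real (q mod p) / real p < 1"
      using less.prems by (auto simp: field_simps)
    ultimately have "frac (real q / real p) = real (q mod p) / real p"
      by (simp only: frac_unique_iff Ints_of_int)
    then show ?thesis
      by (simp add: gauss_map_def)
  qed
  show ?case
  proof (cases "q mod p = 0")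
    case True
    then have "(gauss_map ^^ 1) (real p / real q) = 0"
      using g by simp
    then show ?thesis
      by blast
  next
    case False
    then obtain n where "(gauss_map ^^ n) (real (q mod p) / real p) = 0"
      using less.IH[of p "q mod p"] less.prems by auto
    then have "(gauss_map ^^ Suc n) (real p / real q) = 0"
      by (simp only: funpow_Suc_right o_apply g)
    then show ?thesis
      by blast
  qed
qed

lemma notin_Rats_of_gauss_orbit:
  assumes "0 < x" "x < 1" "\<And>n. (gauss_map ^^ n) x \<noteq> 0"
  shows "x \<notin> \<rat>"
proof
  assume "x \<in> \<rat>"
  then obtain p q :: nat where "q \<noteq> 0" "\<bar>x\<bar> = real p / real q"
    by (rule Rats_abs_nat_div_natE)
  then have x: "x = real p / real q" and "q > 0"
    using assms(1) by auto
  then have "0 < p" "p < q"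
    using assms(1,2) by (simp_all add: zero_less_divide_iff)
  then show False
    using rational_gauss_orbit_hits_zero[of p q] assms(3) x by auto
qed

section \<open>Numbers with prescribed quotients\<close>

text \<open>For positive digits, the closed interval of continued fractions beginning with the first
  \<open>n\<close> terms of \<open>a\<close>, built from the inverse branches of the Gauss map. Its
  endpoints are included so that compactness yields a common point.\<close>

fun cf_fiber :: "nat \<Rightarrow> (nat \<Rightarrow> nat) \<Rightarrow> real set" where
  "cf_fiber 0 a = {0..1}"
| "cf_fiber (Suc n) a = (\<lambda>y. 1 / (real (a 0) + y)) ` cf_fiber n (a \<circ> Suc)"

lemma cf_fiber_subset:
  assumes "\<And>n. 1 \<le> a n"
  shows "cf_fiber n a \<subseteq> {0..1}"
  using assms
proof (induction n arbitrary: a)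
  case (Suc n)
  have "cf_fiber n (a \<circ> Suc) \<subseteq> {0..1}"
    using Suc.prems by (intro Suc.IH) simp
  moreover have "1 \<le> real (a 0)"
    using Suc.prems[of 0] by simp
  ultimately show ?case
    by (auto simp: field_simps)
qed simp

lemma compact_cf_fiber:
  assumes "\<And>n. 1 \<le> a n"
  shows "compact (cf_fiber n a)"
  using assms
proof (induction n arbitrary: a)
  case (Suc n)
  have "compact (cf_fiber n (a \<circ> Suc))"
    using Suc.prems by (intro Suc.IH) simp
  moreover have "real (a 0) + y \<noteq> 0" if "y \<in> cf_fiber n (a \<circ> Suc)" for y
    using that cf_fiber_subset[of "a \<circ> Suc" n] Suc.prems[of 0] Suc.prems by fastforce
  ultimately show ?case
    by (auto intro!: compact_continuous_image continuous_intros)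
qed simp

lemma cf_fiber_nonempty: "cf_fiber n a \<noteq> {}"
  by (induction n arbitrary: a) auto

lemma cf_fiber_Suc_subset:
  assumes "\<And>n. 1 \<le> a n"
  shows "cf_fiber (Suc n) a \<subseteq> cf_fiber n a"
  using assms
proof (induction n arbitrary: a)
  case 0
  then show ?case
    using cf_fiber_subset[of a "Suc 0"] by simp
next
  case (Suc n)
  have "cf_fiber (Suc n) (a \<circ> Suc) \<subseteq> cf_fiber n (a \<circ> Suc)"
    using Suc.prems by (intro Suc.IH) simp
  from image_mono[OF this] show ?case
    by (simp only: cf_fiber.simps(2))
qed

lemma cf_fiber_Inter_nonempty:
  assumes "\<And>n. 1 \<le> a n"
  shows "(\<Inter>n. cf_fiber n a) \<noteq> {}"
proof (rule compact_nest)
  show "cf_fiber n a \<subseteq> cf_fiber m a" if "m \<le> n" for m n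
    using that by (rule lift_Suc_antimono_le[rotated]) (rule cf_fiber_Suc_subset[OF assms])
qed (use assms compact_cf_fiber cf_fiber_nonempty in auto)

text \<open>Undoing the outermost branch gives \<open>1 / x - real (a 0)\<close>, which does not
  depend on \<open>n\<close> and so lies in all fibers of the shifted sequence.\<close>

lemma cf_fiber_Inter_step:
  assumes a: "\<And>n. 1 \<le> a n" and x: "x \<in> (\<Inter>n. cf_fiber n a)"
  shows "0 < x" and "1 / x - real (a 0) \<in> (\<Inter>n. cf_fiber n (a \<circ> Suc))"
proof -
  obtain y where y: "y \<in> {0..1}" "x = 1 / (real (a 0) + y)"
    using x by (auto dest!: spec[of _ "Suc 0"])
  then show "0 < x"
    using a[of 0] by auto
  have "1 / x - real (a 0) \<in> cf_fiber n (a \<circ> Suc)" for n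
  proof -
    have "x \<in> cf_fiber (Suc n) a"
      using x by blast
    then obtain z where "z \<in> cf_fiber n (a \<circ> Suc)" "x = 1 / (real (a 0) + z)"
      by auto
    then show ?thesis
      by simp
  qed
  then show "1 / x - real (a 0) \<in> (\<Inter>n. cf_fiber n (a \<circ> Suc))"
    by blast
qed

lemma cf_fiber_Inter_gauss_map:
  assumes a: "\<And>n. 1 \<le> a n" and x: "x \<in> (\<Inter>n. cf_fiber n a)"
  shows "0 < x" "x < 1" "\<lfloor>1 / x\<rfloor> = int (a 0)" "gauss_map x \<in> (\<Inter>n. cf_fiber n (a \<circ> Suc))"
proof -
  \<comment> \<open>The fibers are closed, so the endpoint 1 has to be excluded: positivity of the
    shifted point makes \<open>1 / z\<close> exceed the first digit.\<close>
  have less1: "z < 1" if "\<And>n. 1 \<le> b n" "z \<in> (\<Inter>n. cf_fiber n b)" for b z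
  proof -
    have "0 < z"
      by (rule cf_fiber_Inter_step(1)[OF that])
    have "0 < 1 / z - real (b 0)"
      by (rule cf_fiber_Inter_step(1)[OF _ cf_fiber_Inter_step(2)[OF that]]) (simp add: that(1)[simplified])
    moreover have "1 \<le> real (b 0)"
      using that(1)[of 0] by simp
    ultimately have "1 < 1 / z"
      by linarith
    with \<open>0 < z\<close> show ?thesis
      by (simp add: field_simps)
  qed
  show "0 < x" "x < 1"
    using cf_fiber_Inter_step(1)[OF a x] less1[OF a x] by auto
  let ?y = "1 / x - real (a 0)"
  have y: "?y \<in> (\<Inter>n. cf_fiber n (a \<circ> Suc))"
    by (rule cf_fiber_Inter_step(2)[OF a x])
  have "0 < ?y" "?y < 1"
    using cf_fiber_Inter_step(1)[OF _ y] less1[OF _ y] a by auto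
  then show fl: "\<lfloor>1 / x\<rfloor> = int (a 0)"
    by linarith
  show "gauss_map x \<in> (\<Inter>n. cf_fiber n (a \<circ> Suc))"
    using y by (simp add: gauss_map_def frac_def fl)
qed

text \<open>Each Gauss iterate of a common point of all fibers is a common point for the shifted
  digits. Hence the orbit never reaches 0, as it would for a rational number.\<close>

lemma ex_irrational_with_cf_quotients:
  fixes a :: "nat \<Rightarrow> nat"
  assumes a: "\<And>n. 1 \<le> a n"
  shows "\<exists>x\<in>{0..<1} - \<rat>. \<forall>n. cf_quotient (Suc n) x = int (a n)"
proof -
  obtain x where x: "x \<in> (\<Inter>n. cf_fiber n a)"
    using cf_fiber_Inter_nonempty[of a, OF a] by blast
  have orbit: "(gauss_map ^^ k) x \<in> (\<Inter>n. cf_fiber n (\<lambda>i. a (i + k)))" for k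
  proof (induction k)
    case 0
    show ?case
      using x by simp
  next
    case (Suc k)
    have "gauss_map ((gauss_map ^^ k) x) \<in> (\<Inter>n. cf_fiber n ((\<lambda>i. a (i + k)) \<circ> Suc))"
      using a by (intro cf_fiber_Inter_gauss_map(4) Suc)
    then show ?case
      by (simp add: o_def)
  qed
  have *: "0 < (gauss_map ^^ k) x" "(gauss_map ^^ k) x < 1" "cf_quotient (Suc k) x = int (a k)" for k
    using cf_fiber_Inter_gauss_map(1-3)[of "\<lambda>i. a (i + k)", OF a orbit[of k]] by (simp_all add: cf_quotient_Suc)
  have "x \<notin> \<rat>"
    using *(1,2)[of 0] by (intro notin_Rats_of_gauss_orbit less_imp_neq[symmetric] *(1)) auto
  then show ?thesis
    using *(1,2)[of 0] *(3) by (intro bexI[of _ x]) auto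
qed

section \<open>Distances along the orbit\<close>

lemma abs_diff_gauss_map:
  assumes "0 < x" "0 < y" "\<lfloor>1 / x\<rfloor> = \<lfloor>1 / y\<rfloor>"
  shows "\<bar>x - y\<bar> = x * y * \<bar>gauss_map x - gauss_map y\<bar>"
proof -
  have "gauss_map x - gauss_map y = 1 / x - 1 / y"
    using assms(3) by (simp add: gauss_map_def frac_def)
  also have "\<dots> = (y - x) / (x * y)"
    using assms by (simp add: field_simps)
  finally show ?thesis
    using assms by (simp add: abs_mult abs_divide)
qed

text \<open>With a common digit, one Gauss step multiplies the distance of \<open>X\<close> and
  \<open>Y\<close> by \<open>1 / (X * Y)\<close>, here at least the square of
  \<open>b k\<close>.\<close>

lemma abs_diff_le_gauss_orbit:
  assumes b: "\<And>k. k < n \<Longrightarrow> 0 < b k"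
    and x: "\<And>k. k < n \<Longrightarrow> 0 < (gauss_map ^^ k) x \<and> (gauss_map ^^ k) x \<le> 1 / b k"
    and y: "\<And>k. k < n \<Longrightarrow> 0 < (gauss_map ^^ k) y \<and> (gauss_map ^^ k) y \<le> 1 / b k"
    and eq: "\<And>k. k < n \<Longrightarrow> cf_quotient (Suc k) x = cf_quotient (Suc k) y"
  shows "\<bar>x - y\<bar> * (\<Prod>k<n. b k)\<^sup>2 \<le> \<bar>(gauss_map ^^ n) x - (gauss_map ^^ n) y\<bar>"
  using assms
proof (induction n)
  case (Suc n)
  let ?X = "(gauss_map ^^ n) x" and ?Y = "(gauss_map ^^ n) y"
  have n: "n < Suc n"
    by simp
  have "\<bar>?X - ?Y\<bar> = ?X * ?Y * \<bar>gauss_map ?X - gauss_map ?Y\<bar>"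
    using Suc.prems[OF n] by (intro abs_diff_gauss_map) (auto simp: cf_quotient_Suc)
  also have "\<dots> \<le> (1 / b n) * (1 / b n) * \<bar>gauss_map ?X - gauss_map ?Y\<bar>"
    using Suc.prems[OF n] by (intro mult_right_mono mult_mono) auto
  finally have step: "\<bar>?X - ?Y\<bar> * (b n)\<^sup>2 \<le> \<bar>gauss_map ?X - gauss_map ?Y\<bar>"
    using Suc.prems(1)[OF n] by (simp add: field_simps power2_eq_square)
  have "\<bar>x - y\<bar> * (\<Prod>k<Suc n. b k)\<^sup>2 = \<bar>x - y\<bar> * (\<Prod>k<n. b k)\<^sup>2 * (b n)\<^sup>2"
    by (simp add: power_mult_distrib)
  also have "\<dots> \<le> \<bar>?X - ?Y\<bar> * (b n)\<^sup>2"
    using Suc.prems by (intro mult_right_mono Suc.IH) auto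
  finally show ?case
    using step by simp
qed simp

text \<open>The opposite estimate: orbit points of size at least \<open>1 / b k\<close> limit the
  expansion of each step to the square of \<open>b k\<close>.\<close>

lemma abs_diff_ge_gauss_orbit:
  assumes b: "\<And>k. k < n \<Longrightarrow> 0 < b k"
    and x: "\<And>k. k < n \<Longrightarrow> 1 / b k \<le> (gauss_map ^^ k) x"
    and y: "\<And>k. k < n \<Longrightarrow> 1 / b k \<le> (gauss_map ^^ k) y"
    and eq: "\<And>k. k < n \<Longrightarrow> cf_quotient (Suc k) x = cf_quotient (Suc k) y"
  shows "\<bar>(gauss_map ^^ n) x - (gauss_map ^^ n) y\<bar> \<le> \<bar>x - y\<bar> * (\<Prod>k<n. b k)\<^sup>2"
  using assms
proof (induction n)
  case (Suc n)
  let ?X = "(gauss_map ^^ n) x" and ?Y = "(gauss_map ^^ n) y"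
  have n: "n < Suc n"
    by simp
  have pos: "0 < 1 / b n"
    using Suc.prems(1)[OF n] by simp
  have XY: "0 < ?X" "0 < ?Y"
    using less_le_trans[OF pos] Suc.prems(2,3)[OF n] by auto
  have "(1 / b n) * (1 / b n) * \<bar>gauss_map ?X - gauss_map ?Y\<bar> \<le> ?X * ?Y * \<bar>gauss_map ?X - gauss_map ?Y\<bar>"
    using Suc.prems(2,3)[OF n] pos XY by (intro mult_right_mono mult_mono) auto
  also have "\<dots> = \<bar>?X - ?Y\<bar>"
    using Suc.prems(4)[OF n] XY
    by (intro abs_diff_gauss_map[symmetric]) (auto simp: cf_quotient_Suc)
  finally have "\<bar>gauss_map ?X - gauss_map ?Y\<bar> \<le> \<bar>?X - ?Y\<bar> * (b n)\<^sup>2"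
    using Suc.prems(1)[OF n] by (simp add: field_simps power2_eq_square)
  also have "\<dots> \<le> \<bar>x - y\<bar> * (\<Prod>k<n. b k)\<^sup>2 * (b n)\<^sup>2"
    using Suc.prems by (intro mult_right_mono Suc.IH) auto
  finally show ?case
    by (simp add: power_mult_distrib)
qed simp

section \<open>Hausdorff measure from above\<close>

text \<open>The scale \<open>c n\<close> governs the quotient number \<open>n + 1\<close>.\<close>

definition cf_set :: "(nat \<Rightarrow> nat) \<Rightarrow> real \<Rightarrow> real set" where
  "cf_set c N = {x \<in> {0..<1} - \<rat>. \<forall>n. int (c n) \<le> cf_quotient (Suc n) x \<and>
     real_of_int (cf_quotient (Suc n) x) < N * real (c n)}"

lemma hausdorff_premeasure_antimono:
  "\<delta>' \<le> \<delta> \<Longrightarrow> hausdorff_premeasure t \<delta> E \<le> hausdorff_premeasure t \<delta>' E"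
  unfolding hausdorff_premeasure_def
  by (rule INF_superset_mono) (auto simp: delta_covers_def intro: order_trans)

text \<open>Enumerating \<open>I\<close> and padding with empty sets, of gauge 0, turns the finite
  cover into a sequence. For positive \<open>t\<close> each gauge is at most
  \<open>\<delta> powr t\<close>.\<close>

lemma hausdorff_premeasure_le_card:
  fixes V :: "'i \<Rightarrow> 'a::metric_space set"
  assumes I: "finite I" and cov: "E \<subseteq> (\<Union>i\<in>I. V i)" and t: "0 < t" and "0 \<le> \<delta>"
    and V: "\<And>i. i \<in> I \<Longrightarrow> bounded (V i)" "\<And>i. i \<in> I \<Longrightarrow> diameter (V i) \<le> \<delta>"
  shows "hausdorff_premeasure t \<delta> E \<le> ennreal (real (card I) * \<delta> powr t)"
proof -
  obtain e where e: "bij_betw e {0..<card I} I"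
    using ex_bij_betw_nat_finite[OF I] by blast
  define U where "U i = (if i < card I then V (e i) else {})" for i
  have eI: "e i \<in> I" if "i < card I" for i
    using e that by (auto simp: bij_betw_def)
  have "E \<subseteq> (\<Union>i. U i)"
  proof
    fix x assume "x \<in> E"
    then obtain j where "j \<in> I" "x \<in> V j"
      using cov by blast
    moreover from \<open>j \<in> I\<close> obtain i where "i < card I" "e i = j"
      using e by (force simp: bij_betw_def)
    ultimately show "x \<in> (\<Union>i. U i)"
      by (auto simp: U_def intro!: exI[of _ i])
  qed
  then have "U \<in> delta_covers \<delta> E"
    using V eI \<open>0 \<le> \<delta>\<close> by (auto simp: delta_covers_def U_def)
  then have "hausdorff_premeasure t \<delta> E \<le> (\<Sum>i. hausdorff_gauge t (U i))"
    unfolding hausdorff_premeasure_def by (rule INF_lower)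
  also have "\<dots> = (\<Sum>i<card I. hausdorff_gauge t (U i))"
    by (rule suminf_finite) (auto simp: U_def hausdorff_gauge_def)
  also have "\<dots> \<le> (\<Sum>i<card I. ennreal (\<delta> powr t))"
    using V eI t
    by (intro sum_mono)
       (auto simp: U_def hausdorff_gauge_def intro!: ennreal_leI powr_mono2 diameter_ge_0)
  also have "\<dots> = ennreal (real (card I) * \<delta> powr t)"
    by (simp add: ennreal_mult ennreal_of_nat_eq_real_of_nat)
  finally show ?thesis .
qed

text \<open>The set fits between its minimum and its maximum. This later counts the next digits that
  occur in a set of small diameter.\<close>

lemma card_le_of_abs_diff_le:
  fixes D :: "nat set"
  assumes D: "finite D" and le: "\<And>i j. i \<in> D \<Longrightarrow> j \<in> D \<Longrightarrow> \<bar>real i - real j\<bar> \<le> L" and "0 \<le> L"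
  shows "real (card D) \<le> 1 + L"
proof (cases "D = {}")
  case False
  then have "Min D \<in> D" "Max D \<in> D"
    using D by auto
  moreover have "D \<subseteq> {Min D..Max D}"
    using D by auto
  then have "card D \<le> card {Min D..Max D}"
    by (intro card_mono) auto
  moreover have "Min D \<le> Max D"
    using \<open>Min D \<in> D\<close> D by simp
  ultimately show ?thesis
    using le[of "Max D" "Min D"] by simp
qed (use \<open>0 \<le> L\<close> in simp)

text \<open>A weighted geometric mean of two upper bounds is an upper bound. It later merges two
  counts of cylinders, one of them linear in the diameter, into a bound with exponent
  \<open>t\<close>.\<close>

lemma min_le_powr_interpolation:
  fixes k A B t :: real
  assumes "0 \<le> k" "k \<le> A" "k \<le> B" "0 \<le> t" "t \<le> 1"
  shows "k \<le> A powr (1 - t) * B powr t"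
proof -
  have "k = k powr (1 - t) * k powr t"
    using assms(1) by (cases "k = 0") (simp_all flip: powr_add)
  also have "\<dots> \<le> A powr (1 - t) * B powr t"
    using assms by (intro mult_mono powr_mono2) auto
  finally show ?thesis .
qed

section \<open>Growth of the products of the scales\<close>

locale cf_digit_scale =
  fixes c :: "nat \<Rightarrow> nat"
  assumes c_ge_3: "\<And>n. 3 \<le> c n" and c_at_top: "filterlim c at_top sequentially"
begin

definition Q :: "nat \<Rightarrow> real" where
  "Q n = (\<Prod>k<n. real (c k))"

text \<open>The term of the lower limit in the dimension formula: \<open>c n\<close> is the scale
  that follows the \<open>n\<close> factors of \<open>Q n\<close>.\<close>

definition ratio :: "nat \<Rightarrow> real" where
  "ratio n = ln (Q n) / (2 * ln (Q n) + ln (real (c n)))"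

lemma Q_Suc: "Q (Suc n) = Q n * real (c n)"
  by (simp add: Q_def)

lemma c_gt_1: "1 < real (c n)"
  using c_ge_3[of n] by simp

lemma Q_ge_1: "1 \<le> Q n"
  using c_gt_1 unfolding Q_def by (intro prod_ge_1) (auto intro: less_imp_le)

lemma Q_pos: "0 < Q n"
  using Q_ge_1[of n] by simp

text \<open>The denominator of \<open>ratio n\<close> is minus the logarithm of the diameter bound
  for cylinders of order \<open>n\<close>, so bounds on \<open>ratio n\<close> become comparisons of
  \<open>Q n\<close> with powers of that diameter.\<close>

lemma ln_Q_sq_c: "ln ((Q n)\<^sup>2 * real (c n)) = 2 * ln (Q n) + ln (real (c n))"
  using Q_pos[of n] c_gt_1[of n] by (simp add: ln_mult ln_realpow)

lemma ratio_denom_pos: "0 < 2 * ln (Q n) + ln (real (c n))"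
  using Q_ge_1[of n] c_gt_1[of n] by (simp add: add_nonneg_pos)

lemma Q_le_Q_sq_c: "Q n \<le> (Q n)\<^sup>2 * real (c n)"
proof -
  have "Q n * (1 * 1) \<le> Q n * (Q n * real (c n))"
    using Q_ge_1[of n] c_gt_1[of n] by (intro mult_left_mono mult_mono) auto
  then show ?thesis
    by (simp add: power2_eq_square mult.assoc)
qed

lemma ratio_nonneg: "0 \<le> ratio n"
  using Q_ge_1[of n] ratio_denom_pos[of n] by (simp add: ratio_def)

text \<open>From some \<open>m\<close> on the scales are at least the square of \<open>K\<close>.
  The square pays for the first \<open>m\<close> factors, as \<open>2 * (n - m) \<ge> n\<close> once
  \<open>n \<ge> 2 * m\<close>.\<close>

lemma eventually_power_le_Q:
  assumes "1 \<le> K"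
  shows "eventually (\<lambda>n. K ^ n \<le> Q n) sequentially"
proof -
  have "eventually (\<lambda>k. nat \<lceil>K\<^sup>2\<rceil> \<le> c k) sequentially"
    using c_at_top unfolding filterlim_at_top by blast
  then obtain m where m: "\<And>k. m \<le> k \<Longrightarrow> nat \<lceil>K\<^sup>2\<rceil> \<le> c k"
    by (auto simp: eventually_sequentially)
  have Km: "K\<^sup>2 \<le> real (c k)" if "m \<le> k" for k
    using m[OF that] by linarith
  have Q: "(K\<^sup>2) ^ j \<le> Q (m + j)" for j
  proof (induction j)
    case 0
    then show ?case
      using Q_ge_1 by simp
  next
    case (Suc j)
    have "(K\<^sup>2) ^ j * K\<^sup>2 \<le> Q (m + j) * real (c (m + j))"
      using Suc Km[of "m + j"] Q_pos[of "m + j"] by (intro mult_mono) auto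
    then show ?case
      by (simp add: Q_Suc mult.commute)
  qed
  have "K ^ n \<le> Q n" if "2 * m \<le> n" for n
  proof -
    have "K ^ n \<le> K ^ (2 * (n - m))"
      using assms that by (intro power_increasing) auto
    also have "\<dots> \<le> Q n"
      using Q[of "n - m"] that by (simp add: power_mult)
    finally show ?thesis .
  qed
  then show ?thesis
    by (auto simp: eventually_sequentially)
qed

text \<open>Lets exponential factors such as \<open>(2 * N) ^ n\<close> and \<open>4 ^ n\<close> be
  absorbed into an arbitrarily small power of \<open>Q n\<close>.\<close>

lemma eventually_power_le_Q_powr:
  assumes "1 \<le> M" "0 < \<eta>"
  shows "eventually (\<lambda>n. M ^ n \<le> Q n powr \<eta>) sequentially"
proof -
  have "1 \<le> M powr (1 / \<eta>)"
    using assms by (simp add: ge_one_powr_ge_zero)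
  from eventually_power_le_Q[OF this] show ?thesis
  proof (rule eventually_mono)
    fix n assume *: "(M powr (1 / \<eta>)) ^ n \<le> Q n"
    have "M ^ n = ((M powr (1 / \<eta>)) ^ n) powr \<eta>"
      using assms by (simp add: powr_powr flip: powr_realpow)
    also have "\<dots> \<le> Q n powr \<eta>"
      using * assms by (intro powr_mono2) auto
    finally show "M ^ n \<le> Q n powr \<eta>" .
  qed
qed

section \<open>Covers by cylinders\<close>

lemma cf_set_orbit_bounds:
  assumes "x \<in> cf_set c N"
  shows "0 < (gauss_map ^^ k) x" and "(gauss_map ^^ k) x \<le> 1 / real (c k)"
proof -
  show pos: "0 < (gauss_map ^^ k) x"
    using assms funpow_gauss_map_bounds by (auto simp: cf_set_def)
  have "int (c k) \<le> \<lfloor>1 / (gauss_map ^^ k) x\<rfloor>"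
    using assms by (auto simp: cf_set_def cf_quotient_Suc)
  then have "real (c k) \<le> 1 / (gauss_map ^^ k) x"
    by linarith
  with pos show "(gauss_map ^^ k) x \<le> 1 / real (c k)"
    using c_gt_1[of k] by (simp add: field_simps)
qed

text \<open>The first \<open>n\<close> steps give the square of \<open>Q n\<close>; the factor
  \<open>c n\<close> appears because both orbit points after these steps lie between 0 and
  \<open>1 / c n\<close>.\<close>

lemma cf_set_cylinder_dist:
  assumes "x \<in> cf_set c N" "y \<in> cf_set c N"
    and "\<And>k. k < n \<Longrightarrow> cf_quotient (Suc k) x = cf_quotient (Suc k) y"
  shows "\<bar>x - y\<bar> \<le> 1 / ((Q n)\<^sup>2 * real (c n))"
proof -
  have "\<bar>x - y\<bar> * (Q n)\<^sup>2 \<le> \<bar>(gauss_map ^^ n) x - (gauss_map ^^ n) y\<bar>"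
    unfolding Q_def using assms cf_set_orbit_bounds c_gt_1
    by (intro abs_diff_le_gauss_orbit) (auto intro: less_trans[OF zero_less_one])
  also have "\<dots> \<le> 1 / real (c n)"
    using cf_set_orbit_bounds[OF assms(1), of n] cf_set_orbit_bounds[OF assms(2), of n]
    by (auto simp: abs_le_iff)
  finally show ?thesis
    using Q_pos[of n] c_gt_1[of n] by (simp add: field_simps)
qed

lemma hausdorff_premeasure_cf_set_le:
  assumes t: "0 < t" and N: "2 \<le> N"
  shows "hausdorff_premeasure t (1 / ((Q n)\<^sup>2 * real (c n))) (cf_set c N)
    \<le> ennreal (N ^ n * Q n * (1 / ((Q n)\<^sup>2 * real (c n))) powr t)"
proof -
  let ?\<delta> = "1 / ((Q n)\<^sup>2 * real (c n))"
  define D where "D k = {i::int. int (c k) \<le> i \<and> real_of_int i < N * real (c k)}" for k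
  define V where "V w = {x \<in> cf_set c N. \<forall>k<n. cf_quotient (Suc k) x = w k}" for w
  let ?I = "Pi\<^sub>E {..<n} D"
  have D: "D k \<subseteq> {int (c k)..<\<lceil>N * real (c k)\<rceil>}" for k
    unfolding D_def by (auto simp: less_ceiling_iff)
  have finD: "finite (D k)" for k
    by (rule finite_subset[OF D]) simp
  \<comment> \<open>Rounding up \<open>N * c k\<close> adds less than 1, and subtracting
    \<open>c k\<close> more than makes up for it.\<close>
  have cardD: "real (card (D k)) \<le> N * real (c k)" for k
  proof -
    have "card (D k) \<le> card {int (c k)..<\<lceil>N * real (c k)\<rceil>}"
      by (rule card_mono[OF _ D]) simp
    moreover have "1 * real (c k) \<le> N * real (c k)"
      using N by (intro mult_right_mono) auto
    moreover have "3 \<le> real (c k)"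
      using c_ge_3[of k] by simp
    ultimately show ?thesis
      unfolding card_atLeastLessThan_int by linarith
  qed
  have cov: "cf_set c N \<subseteq> (\<Union>w\<in>?I. V w)"
  proof
    fix x assume x: "x \<in> cf_set c N"
    let ?w = "restrict (\<lambda>k. cf_quotient (Suc k) x) {..<n}"
    have "?w \<in> ?I" "x \<in> V ?w"
      using x by (auto simp: D_def V_def cf_set_def)
    then show "x \<in> (\<Union>w\<in>?I. V w)"
      by blast
  qed
  have bV: "bounded (V w)" for w
    by (rule bounded_subset[of "{0..1}"]) (auto simp: V_def cf_set_def)
  have dV: "diameter (V w) \<le> ?\<delta>" for w
    by (rule diameter_le) (auto simp: V_def intro!: cf_set_cylinder_dist)
  have "hausdorff_premeasure t ?\<delta> (cf_set c N) \<le> ennreal (real (card ?I) * ?\<delta> powr t)"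
    by (rule hausdorff_premeasure_le_card[OF _ cov t]) (auto simp: bV dV finD intro!: finite_PiE)
  also have "real (card ?I) \<le> N ^ n * Q n"
  proof -
    have "real (card ?I) = (\<Prod>k<n. real (card (D k)))"
      by (simp add: card_PiE)
    also have "\<dots> \<le> (\<Prod>k<n. N * real (c k))"
      using cardD by (intro prod_mono) auto
    also have "\<dots> = N ^ n * Q n"
      by (simp add: Q_def prod.distrib)
    finally show ?thesis .
  qed
  finally show ?thesis
    by (simp add: mult_right_mono ennreal_leI)
qed

text \<open>The lower limit controls only infinitely many levels \<open>n\<close>, but one suitable
  level suffices for given \<open>\<delta>\<close> and \<open>e\<close>. Choosing \<open>u\<close>
  strictly below \<open>t\<close> leaves a spare exponent \<open>t - u\<close> to absorb the factor
  \<open>N ^ n\<close> in the number of cylinders.\<close>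

theorem hausdorff_measure_cf_set_eq_0:
  assumes N: "2 \<le> N" and t: "liminf (\<lambda>n. ereal (ratio n)) < ereal t"
  shows "hausdorff_measure t (cf_set c N) = 0"
proof -
  obtain u where u: "liminf (\<lambda>n. ereal (ratio n)) < ereal u" "u < t"
    using ereal_dense2[OF t] by auto
  have "0 \<le> liminf (\<lambda>n. ereal (ratio n))"
    by (rule Liminf_bounded) (simp add: ratio_nonneg)
  with u have "0 < u"
    by (metis ereal_less(2) le_less_trans)
  with u have "0 < t"
    by simp
  have freq: "frequently (\<lambda>n. ratio n < u) sequentially"
  proof (rule ccontr)
    assume "\<not> ?thesis"
    then have "eventually (\<lambda>n. ereal u \<le> ereal (ratio n)) sequentially"
      by (simp add: not_frequently not_less)
    then have "ereal u \<le> liminf (\<lambda>n. ereal (ratio n))"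
      by (rule Liminf_bounded)
    with u(1) show False
      by simp
  qed
  \<comment> \<open>\<open>ratio n < u\<close> bounds \<open>Q n\<close> by
    \<open>?R powr u\<close>. The comparison with \<open>(2 * N) ^ n\<close> instead of
    \<open>N ^ n\<close> leaves a null sequence.\<close>
  have small: "N ^ n * Q n * (1 / ((Q n)\<^sup>2 * real (c n))) powr t \<le> (1 / 2) ^ n"
    if r: "ratio n < u" and pw: "(2 * N) ^ n \<le> Q n powr (t - u)" for n
  proof -
    let ?R = "(Q n)\<^sup>2 * real (c n)"
    have R: "Q n \<le> ?R" "1 \<le> ?R"
      using Q_le_Q_sq_c[of n] Q_ge_1[of n] by linarith+
    have "ln (Q n) \<le> u * ln ?R"
      using r ratio_denom_pos[of n] unfolding ratio_def ln_Q_sq_c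
      by (simp add: pos_divide_less_eq)
    then have "exp (ln (Q n)) \<le> exp (u * ln ?R)"
      by simp
    then have QR: "Q n \<le> ?R powr u"
      using Q_pos[of n] c_ge_3[of n] by (simp add: powr_def)
    have "N ^ n * Q n * (1 / ?R) powr t \<le> N ^ n * ?R powr u * (1 / ?R) powr t"
      using QR N by (intro mult_right_mono mult_left_mono) auto
    also have "\<dots> = N ^ n * ?R powr (- (t - u))"
      using R by (simp add: powr_divide powr_minus powr_diff divide_simps del: of_nat_mult)
    also have "\<dots> \<le> N ^ n * Q n powr (- (t - u))"
      using R Q_pos[of n] N u(2) by (intro mult_left_mono powr_mono2') auto
    also have "\<dots> = N ^ n / Q n powr (t - u)"
      by (subst powr_minus) (simp add: divide_inverse)
    also have "\<dots> \<le> N ^ n / (2 * N) ^ n"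
      using pw N Q_pos[of n] by (intro divide_left_mono) auto
    also have "\<dots> = (1 / 2) ^ n"
      using N by (simp add: power_mult_distrib field_simps)
    finally show ?thesis .
  qed
  have le_eps: "hausdorff_premeasure t \<delta> (cf_set c N) \<le> 0 + ennreal e" if "0 < \<delta>" "0 < e" for \<delta> e
  proof -
    have "(\<lambda>n. (1 / 2) ^ n :: real) \<longlonglongrightarrow> 0"
      by (rule LIMSEQ_power_zero) simp
    then have ev: "eventually (\<lambda>n. (1 / 2) ^ n < min \<delta> e) sequentially"
      using that by (intro order_tendstoD(2)) auto
    \<comment> \<open>The bound \<open>2 ^ n \<le> Q n\<close> makes the cylinders smaller than
      \<open>\<delta>\<close>; the first bound makes the cost of the cover smaller than
      \<open>e\<close>.\<close>
    have ev2: "eventually (\<lambda>n. (2 * N) ^ n \<le> Q n powr (t - u) \<and> 2 ^ n \<le> Q n \<and>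
        (1 / 2) ^ n < min \<delta> e) sequentially"
      using N u(2) by (intro eventually_conj eventually_power_le_Q_powr eventually_power_le_Q ev) auto
    have "\<exists>n. ratio n < u \<and> (2 * N) ^ n \<le> Q n powr (t - u) \<and> 2 ^ n \<le> Q n \<and> (1 / 2) ^ n < min \<delta> e"
      using frequently_ex[OF frequently_eventually_conj[OF freq ev2]] by blast
    then obtain n where n: "ratio n < u" "(2 * N) ^ n \<le> Q n powr (t - u)" "2 ^ n \<le> Q n"
      "(1 / 2) ^ n < min \<delta> e"
      by blast
    let ?\<delta> = "1 / ((Q n)\<^sup>2 * real (c n))"
    have "?\<delta> \<le> 1 / 2 ^ n"
      using n(3) Q_le_Q_sq_c[of n] Q_pos[of n] c_gt_1[of n] by (intro divide_left_mono) auto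
    then have "?\<delta> \<le> \<delta>"
      using n(4) by (simp add: power_one_over)
    then have "hausdorff_premeasure t \<delta> (cf_set c N) \<le> hausdorff_premeasure t ?\<delta> (cf_set c N)"
      by (rule hausdorff_premeasure_antimono)
    also have "\<dots> \<le> ennreal (N ^ n * Q n * ?\<delta> powr t)"
      by (rule hausdorff_premeasure_cf_set_le[OF \<open>0 < t\<close> N])
    also have "\<dots> \<le> ennreal e"
      using small[OF n(1,2)] n(4) by (intro ennreal_leI) simp
    finally show ?thesis
      by simp
  qed
  have "hausdorff_premeasure t \<delta> (cf_set c N) \<le> 0" if "0 < \<delta>" for \<delta>
    by (rule ennreal_le_epsilon) (rule le_eps[OF that])
  then have "hausdorff_measure t (cf_set c N) \<le> 0"
    unfolding hausdorff_measure_def by (intro SUP_least) simp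
  then show ?thesis
    by simp
qed

section \<open>Hausdorff measure from below\<close>

text \<open>Separation of points with digits in \<open>{c k..<2 * c k}\<close> that share
  \<open>n\<close> digits, per unit of difference in the next one. The power of 4 stems from the
  factor 2 in the upper digit bound at the first \<open>n\<close> places; 6 is another such 4 times
  3/2, the loss caused by the tails.\<close>

definition gap :: "nat \<Rightarrow> real" where
  "gap n = 1 / (6 * 4 ^ n * (Q (Suc n))\<^sup>2)"

lemma gap_pos: "0 < gap n"
  using Q_pos[of "Suc n"] by (simp add: gap_def)

lemma gap_le_power: "gap n \<le> (1 / 4) ^ n"
proof -
  have "1 * 4 ^ n * 1 \<le> 6 * 4 ^ n * (Q (Suc n))\<^sup>2"
    using Q_ge_1[of "Suc n"] by (intro mult_mono) (auto simp: one_le_power)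
  then have "gap n \<le> 1 / 4 ^ n"
    unfolding gap_def using Q_pos[of "Suc n"] by (intro divide_left_mono) auto
  then show ?thesis
    by (simp add: power_one_over)
qed

lemma cf_set_2_orbit_ge:
  assumes "x \<in> cf_set c 2"
  shows "1 / (2 * real (c k)) \<le> (gauss_map ^^ k) x"
proof -
  have pos: "0 < (gauss_map ^^ k) x"
    by (rule cf_set_orbit_bounds(1)[OF assms])
  have "\<lfloor>1 / (gauss_map ^^ k) x\<rfloor> < 2 * int (c k)"
    using assms by (auto simp: cf_set_def cf_quotient_Suc dest!: spec[of _ k])
  \<comment> \<open>The digit is an integer below \<open>2 * c k\<close>, which leaves room for the
    fractional part.\<close>
  then have "1 / (gauss_map ^^ k) x \<le> 2 * real (c k)"
    by linarith
  with pos show ?thesis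
    using c_gt_1[of k] by (simp add: field_simps)
qed

lemma cf_set_2_dist_ge:
  assumes x: "x \<in> cf_set c 2" and y: "y \<in> cf_set c 2"
    and eq: "\<And>k. k < n \<Longrightarrow> cf_quotient (Suc k) x = cf_quotient (Suc k) y"
  shows "gap n * \<bar>real_of_int (cf_quotient (Suc n) x - cf_quotient (Suc n) y)\<bar> \<le> \<bar>x - y\<bar>"
proof (cases "cf_quotient (Suc n) x = cf_quotient (Suc n) y")
  case False
  let ?X = "(gauss_map ^^ n) x" and ?Y = "(gauss_map ^^ n) y"
  let ?d = "\<bar>real_of_int (cf_quotient (Suc n) x - cf_quotient (Suc n) y)\<bar>"
  let ?C = "real (c n)"
  have d1: "1 \<le> ?d"
    using False by linarith
  have X: "0 < ?X" "1 / (2 * ?C) \<le> ?X" and Y: "0 < ?Y" "1 / (2 * ?C) \<le> ?Y"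
    using cf_set_orbit_bounds(1) cf_set_2_orbit_ge x y by blast+
  have third: "1 / real (c k) \<le> 1 / 3" for k
    using c_ge_3[of k] by (intro divide_left_mono) auto
  \<comment> \<open>Scales of at least 3 put both tails into the interval from 0 to 1/3, so the
    reciprocals differ by at least \<open>?d - 1 / 3\<close>, and \<open>?d\<close> is at least
    1.\<close>
  have "2 / 3 * ?d \<le> \<bar>1 / ?X - 1 / ?Y\<bar>"
  proof -
    have "0 < (gauss_map ^^ Suc n) x" "(gauss_map ^^ Suc n) x \<le> 1 / 3"
      "0 < (gauss_map ^^ Suc n) y" "(gauss_map ^^ Suc n) y \<le> 1 / 3"
      using cf_set_orbit_bounds[OF x, of "Suc n"] cf_set_orbit_bounds[OF y, of "Suc n"]
        third[of "Suc n"] by linarith+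
    then have "?d - 1 / 3 \<le> \<bar>1 / ?X - 1 / ?Y\<bar>"
      unfolding inverse_eq_quotient_plus_gauss_map by linarith
    moreover have "2 / 3 * v \<le> z" if "v - 1 / 3 \<le> z" "1 \<le> v" for v z :: real
      using that by simp
    ultimately show ?thesis
      using d1 by blast
  qed
  moreover have "\<bar>?X - ?Y\<bar> = ?X * ?Y * \<bar>1 / ?X - 1 / ?Y\<bar>"
  proof -
    have "1 / ?X - 1 / ?Y = (?Y - ?X) / (?X * ?Y)"
      using X Y by (simp add: field_simps)
    then show ?thesis
      using X Y by (simp add: abs_mult)
  qed
  moreover have "1 / (2 * ?C) * (1 / (2 * ?C)) * (2 / 3 * ?d) \<le> ?X * ?Y * \<bar>1 / ?X - 1 / ?Y\<bar>"
    using X Y calculation(1) by (intro mult_mono) auto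
  ultimately have "?d / (6 * ?C\<^sup>2) \<le> \<bar>?X - ?Y\<bar>"
    by (simp add: power2_eq_square field_simps)
  also have "\<dots> \<le> \<bar>x - y\<bar> * (\<Prod>k<n. 2 * real (c k))\<^sup>2"
    using cf_set_2_orbit_ge[OF x] cf_set_2_orbit_ge[OF y] eq c_gt_1
    by (intro abs_diff_ge_gauss_orbit) (auto intro: less_trans[OF zero_less_one])
  also have "\<dots> = \<bar>x - y\<bar> * (4 ^ n * (Q n)\<^sup>2)"
    by (simp add: Q_def prod.distrib power_mult_distrib power2_eq_square flip: power_mult_distrib)
  finally have "?d / (6 * ?C\<^sup>2) \<le> \<bar>x - y\<bar> * (4 ^ n * (Q n)\<^sup>2)" .
  then show ?thesis
    using Q_pos[of n] c_gt_1[of n]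
    by (simp add: gap_def Q_Suc power_mult_distrib field_simps)
qed simp

section \<open>Random digit sequences\<close>

abbreviation digit_measure :: "nat \<Rightarrow> nat measure" where
  "digit_measure k \<equiv> measure_pmf (pmf_of_set {c k..<2 * c k})"

abbreviation word_measure :: "(nat \<Rightarrow> nat) measure" where
  "word_measure \<equiv> Pi\<^sub>M UNIV digit_measure"

definition words :: "(nat \<Rightarrow> nat) set" where
  "words = {\<omega>. \<forall>k. \<omega> k \<in> {c k..<2 * c k}}"

lemma digit_range_nonempty: "{c k..<2 * c k} \<noteq> {}"
  using c_ge_3[of k] by auto

lemma product_prob_space_digit_measure: "product_prob_space digit_measure"
  by (rule product_prob_spaceI) (rule prob_space_measure_pmf)

lemma AE_words: "AE \<omega> in word_measure. \<omega> \<in> words"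
proof -
  have "AE \<omega> in word_measure. \<omega> k \<in> {c k..<2 * c k}" for k
    by (rule AE_PiM_component[where P = "\<lambda>i. i \<in> {c k..<2 * c k}"])
       (use digit_range_nonempty[of k] in \<open>auto simp: AE_measure_pmf_iff prob_space_measure_pmf\<close>)
  then show ?thesis
    by (simp add: words_def AE_all_countable)
qed

lemma emeasure_digit_measure:
  "D \<subseteq> {c k..<2 * c k} \<Longrightarrow> emeasure (digit_measure k) D = ennreal (real (card D) / real (c k))"
  using digit_range_nonempty[of k] by (simp add: emeasure_pmf_of_set Int_absorb1)

text \<open>A set \<open>D\<close> in the last coordinate handles several cylinders of order
  \<open>n + 1\<close> inside one of order \<open>n\<close> at once. By independence each fixed
  digit contributes \<open>1 / c k\<close> and the last one \<open>card D / c n\<close>.\<close>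

lemma emeasure_cylinder:
  assumes w: "w \<in> words" and D: "D \<subseteq> {c n..<2 * c n}"
  shows "{\<omega>. (\<forall>k<n. \<omega> k = w k) \<and> \<omega> n \<in> D} \<in> sets word_measure"
    and "emeasure word_measure {\<omega>. (\<forall>k<n. \<omega> k = w k) \<and> \<omega> n \<in> D} =
      ennreal (real (card D) / Q (Suc n))"
proof -
  interpret product_prob_space digit_measure UNIV
    by (rule product_prob_space_digit_measure)
  define X where "X k = (if k = n then D else {w k})" for k
  have eq: "{\<omega>. (\<forall>k<n. \<omega> k = w k) \<and> \<omega> n \<in> D} = {\<omega> \<in> space word_measure. \<forall>k\<in>{..n}. \<omega> k \<in> X k}"
    by (auto simp: space_PiM X_def)
  show "{\<omega>. (\<forall>k<n. \<omega> k = w k) \<and> \<omega> n \<in> D} \<in> sets word_measure"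
    unfolding eq by measurable
  have "emeasure word_measure {\<omega> \<in> space word_measure. \<forall>k\<in>{..n}. \<omega> k \<in> X k} =
      (\<Prod>k\<le>n. emeasure (digit_measure k) (X k))"
    by (rule emeasure_PiM_Collect) auto
  also have "\<dots> = (\<Prod>k\<le>n. ennreal (real (card (X k)) / real (c k)))"
    using w D by (intro prod.cong emeasure_digit_measure) (auto simp: X_def words_def)
  also have "\<dots> = ennreal (\<Prod>k\<le>n. real (card (X k)) / real (c k))"
    by (rule prod_ennreal) simp
  also have "(\<Prod>k\<le>n. real (card (X k)) / real (c k)) = real (card D) / Q (Suc n)"
    by (simp add: X_def Q_def prod_dividef flip: lessThan_Suc_atMost)
  finally show "emeasure word_measure {\<omega>. (\<forall>k<n. \<omega> k = w k) \<and> \<omega> n \<in> D} =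
      ennreal (real (card D) / Q (Suc n))"
    unfolding eq .
qed

section \<open>Coding by words and the mass of small sets\<close>

lemma ex_cf_set_point:
  assumes "\<omega> \<in> words"
  shows "\<exists>x\<in>cf_set c 2. \<forall>n. cf_quotient (Suc n) x = int (\<omega> n)"
proof -
  have w: "c n \<le> \<omega> n" "\<omega> n < 2 * c n" for n
    using assms by (auto simp: words_def)
  have "1 \<le> \<omega> n" for n
    using w(1)[of n] c_ge_3[of n] by linarith
  then obtain x where x: "x \<in> {0..<1} - \<rat>" "\<And>n. cf_quotient (Suc n) x = int (\<omega> n)"
    using ex_irrational_with_cf_quotients[of \<omega>] by blast
  then have "x \<in> cf_set c 2"
    using w by (simp add: cf_set_def) (metis of_nat_less_iff of_nat_mult of_nat_numeral)
  with x(2) show ?thesis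
    by blast
qed

text \<open>The digit sequences of points of \<open>U\<close>, given by a relation instead of a
  preimage under a coding map. Mass estimates reach this set through measurable sets that contain
  it.\<close>

definition coded :: "real set \<Rightarrow> (nat \<Rightarrow> nat) set" where
  "coded U = {\<omega> \<in> words. \<exists>x\<in>U \<inter> cf_set c 2. \<forall>n. cf_quotient (Suc n) x = int (\<omega> n)}"

text \<open>The estimate behind the mass distribution principle. Up to the first level whose gap is
  at most \<open>r\<close> all digits agree; at that level the number of digits is bounded both by
  \<open>c n\<close> and by a multiple of \<open>r\<close>, and interpolation gives the power
  \<open>t\<close>.\<close>

lemma coded_subset_small_cylinder:
  assumes r: "0 < r" and U: "\<And>x y. x \<in> U \<Longrightarrow> y \<in> U \<Longrightarrow> \<bar>x - y\<bar> \<le> r"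
    and small: "\<And>m. m < n0 \<Longrightarrow> r < gap m" and t: "0 \<le> t" "t \<le> 1"
    and bound: "\<And>n. n0 \<le> n \<Longrightarrow> (4 ^ n * ((Q n)\<^sup>2 * real (c n))) powr t \<le> Q n"
  shows "\<exists>B\<in>sets word_measure. coded U \<subseteq> B \<and> emeasure word_measure B \<le> ennreal ((12 * r) powr t)"
proof (cases "coded U = {}")
  case True
  then show ?thesis
    by (intro bexI[of _ "{}"]) auto
next
  case False
  then obtain w where w: "w \<in> coded U"
    by blast
  have "\<exists>n. gap n \<le> r"
  proof -
    obtain n where "(1 / 4) ^ n < r"
      using real_arch_pow_inv[OF r, of "1 / 4"] by auto
    then show ?thesis
      using gap_le_power[of n] by (intro exI[of _ n]) simp
  qed
  \<comment> \<open>Minimality makes \<open>r\<close> smaller than every earlier gap, which forces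
    agreement of the first \<open>n\<close> digits; \<open>small\<close> ensures that
    \<open>n\<close> is at least \<open>n0\<close>.\<close>
  define n where "n = (LEAST n. gap n \<le> r)"
  have n: "gap n \<le> r"
    unfolding n_def using \<open>\<exists>n. gap n \<le> r\<close> by (rule LeastI_ex)
  have below: "r < gap m" if "m < n" for m
    using that not_less_Least[of m "\<lambda>n. gap n \<le> r"] by (simp add: n_def)
  have "n0 \<le> n"
    using small n by (meson not_less)
  have dist: "gap m * \<bar>real (\<omega> m) - real (\<omega>' m)\<bar> \<le> r"
    if \<omega>: "\<omega> \<in> coded U" "\<omega>' \<in> coded U" "\<And>k. k < m \<Longrightarrow> \<omega> k = \<omega>' k" for \<omega> \<omega>' m
  proof -
    obtain x y where "x \<in> U" "x \<in> cf_set c 2" "\<And>n. cf_quotient (Suc n) x = int (\<omega> n)"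
      and "y \<in> U" "y \<in> cf_set c 2" "\<And>n. cf_quotient (Suc n) y = int (\<omega>' n)"
      using \<omega>(1,2) by (auto simp: coded_def)
    then show ?thesis
      using cf_set_2_dist_ge[of x y m] \<omega>(3) U[of x y] by simp
  qed
  have agree: "\<omega> m = w m" if \<omega>: "\<omega> \<in> coded U" and "m < n" for \<omega> m
    using \<open>m < n\<close>
  proof (induction m rule: less_induct)
    case (less m)
    have "gap m * \<bar>real (\<omega> m) - real (w m)\<bar> \<le> r"
      using less by (intro dist \<omega> w) auto
    also have "r < gap m * 1"
      using below[OF less.prems] by simp
    finally have "\<bar>real (\<omega> m) - real (w m)\<bar> < 1"
      using gap_pos[of m] by simp
    then show ?case
      by linarith
  qed
  define D where "D = (\<lambda>\<omega>. \<omega> n) ` coded U"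
  have D: "D \<subseteq> {c n..<2 * c n}"
    by (auto simp: D_def coded_def words_def)
  then have finD: "finite D"
    by (rule finite_subset) simp
  let ?B = "{\<omega>. (\<forall>k<n. \<omega> k = w k) \<and> \<omega> n \<in> D}"
  have "w \<in> words"
    using w by (simp add: coded_def)
  note B = emeasure_cylinder[OF this D]
  let ?C = "real (c n)"
  have card1: "real (card D) \<le> ?C"
    using card_mono[OF _ D] by simp
  have card2: "real (card D) \<le> 2 * r / gap n"
  proof -
    have "real (card D) \<le> 1 + r / gap n"
    proof (rule card_le_of_abs_diff_le[OF finD])
      fix i j assume "i \<in> D" "j \<in> D"
      then obtain \<omega> \<omega>' where "\<omega> \<in> coded U" "\<omega>' \<in> coded U" "i = \<omega> n" "j = \<omega>' n"
        by (auto simp: D_def)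
      then have "gap n * \<bar>real i - real j\<bar> \<le> r"
        using dist[of \<omega> \<omega>' n] agree[of \<omega>] agree[of \<omega>'] by metis
      then show "\<bar>real i - real j\<bar> \<le> r / gap n"
        using gap_pos[of n] by (simp add: field_simps)
    qed (use r gap_pos[of n] in simp)
    moreover have "1 \<le> r / gap n"
      using n gap_pos[of n] by simp
    ultimately show ?thesis
      by simp
  qed
  let ?G = "4 ^ n * ((Q n)\<^sup>2 * ?C)"
  have G: "0 < ?G"
    using Q_pos[of n] c_gt_1[of n] by simp
  \<comment> \<open>12 is the 2 of the count times the 6 in \<open>gap\<close>. One factor
    \<open>c n\<close> is split off, so that the powers \<open>1 - t\<close> and \<open>t\<close> of
    \<open>c n\<close> recombine.\<close>
  have "2 * r / gap n = 12 * r * (?G * ?C)"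
    by (simp add: gap_def Q_Suc power2_eq_square algebra_simps)
  then have "real (card D) \<le> ?C powr (1 - t) * (12 * r * (?G * ?C)) powr t"
    using card1 card2 t by (intro min_le_powr_interpolation) auto
  also have "\<dots> = ?C powr (1 - t) * ?C powr t * (12 * r) powr t * ?G powr t"
    using r G c_gt_1[of n] by (simp add: powr_mult del: of_nat_mult)
  also have "\<dots> = ?C * (12 * r) powr t * ?G powr t"
    using c_gt_1[of n] by (simp flip: powr_add)
  also have "\<dots> \<le> ?C * (12 * r) powr t * Q n"
    using bound[OF \<open>n0 \<le> n\<close>] by (intro mult_left_mono) auto
  finally have "real (card D) / Q (Suc n) \<le> (12 * r) powr t"
    using Q_pos[of n] c_gt_1[of n] by (simp add: Q_Suc field_simps)
  then have "emeasure word_measure ?B \<le> ennreal ((12 * r) powr t)"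
    unfolding B(2) by (rule ennreal_leI)
  moreover have "coded U \<subseteq> ?B"
    using agree by (auto simp: D_def)
  ultimately show ?thesis
    using B(1) by blast
qed

text \<open>For \<open>u\<close> strictly between \<open>t\<close> and the lower limit,
  \<open>u < ratio n\<close> bounds the power \<open>u\<close> of the inverse cylinder diameter by
  \<open>Q n\<close>. The spare exponent \<open>u - t\<close> absorbs \<open>4 ^ n\<close>;
  \<open>t\<close> is at most 1 because every \<open>ratio n\<close> is.\<close>

lemma eventually_mass_bound:
  assumes t: "0 \<le> t" "ereal t < liminf (\<lambda>n. ereal (ratio n))"
  shows "t \<le> 1"
    and "eventually (\<lambda>n. (4 ^ n * ((Q n)\<^sup>2 * real (c n))) powr t \<le> Q n) sequentially"
proof -
  obtain u where u: "t < u" "ereal u < liminf (\<lambda>n. ereal (ratio n))"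
    using ereal_dense2[OF t(2)] by auto
  have ev: "eventually (\<lambda>n. u < ratio n) sequentially"
    using less_LiminfD[OF u(2)] by simp
  have ratio_le: "ratio n \<le> 1" for n
    using Q_ge_1[of n] c_gt_1[of n] ratio_denom_pos[of n] by (simp add: ratio_def add_nonneg_nonneg)
  obtain n where "u < ratio n"
    using eventually_happens[OF ev] by auto
  with ratio_le[of n] u(1) show t1: "t \<le> 1"
    by linarith
  have "eventually (\<lambda>n. 4 ^ n \<le> Q n powr (u - t)) sequentially"
    using u(1) by (intro eventually_power_le_Q_powr) auto
  with ev show "eventually (\<lambda>n. (4 ^ n * ((Q n)\<^sup>2 * real (c n))) powr t \<le> Q n) sequentially"
  proof eventually_elim
    case (elim n)
    let ?R = "(Q n)\<^sup>2 * real (c n)"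
    have R: "Q n \<le> ?R" "1 \<le> ?R"
      using Q_le_Q_sq_c[of n] Q_ge_1[of n] by linarith+
    have "u * ln ?R \<le> ln (Q n)"
      using elim(1) ratio_denom_pos[of n] unfolding ratio_def ln_Q_sq_c
      by (simp add: pos_less_divide_eq)
    then have "exp (u * ln ?R) \<le> exp (ln (Q n))"
      by simp
    then have QR: "?R powr u \<le> Q n"
      using Q_pos[of n] c_ge_3[of n] by (simp add: powr_def)
    have "(4 ^ n :: real) powr t \<le> (4 ^ n) powr 1"
      using t1 by (intro powr_mono) (auto simp: one_le_power)
    also have "\<dots> \<le> Q n powr (u - t)"
      using elim(2) by simp
    also have "\<dots> \<le> ?R powr (u - t)"
      using R Q_pos[of n] u(1) by (intro powr_mono2) auto
    finally have "(4 ^ n * ?R) powr t \<le> ?R powr (u - t) * ?R powr t"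
      using R by (simp add: powr_mult mult_right_mono)
    also have "\<dots> = ?R powr u"
      using R by (simp flip: powr_add)
    finally show ?case
      using QR by simp
  qed
qed

text \<open>The mass distribution principle, with the mass carried by the smaller set for
  \<open>N = 2\<close>: a cover by small sets induces a cover of almost all words, so its total
  gauge is at least \<open>(1 / 12) powr t\<close>.\<close>

theorem hausdorff_measure_cf_set_neq_0:
  assumes N: "2 \<le> N" and t: "0 \<le> t" "ereal t < liminf (\<lambda>n. ereal (ratio n))"
  shows "hausdorff_measure t (cf_set c N) \<noteq> 0"
proof -
  interpret product_prob_space digit_measure UNIV
    by (rule product_prob_space_digit_measure)
  note t1 = eventually_mass_bound(1)[OF t]
  obtain n0 where n0: "\<And>n. n0 \<le> n \<Longrightarrow> (4 ^ n * ((Q n)\<^sup>2 * real (c n))) powr t \<le> Q n"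
    using eventually_mass_bound(2)[OF t] by (auto simp: eventually_sequentially)
  \<comment> \<open>Keeps the radii below all gaps of order less than \<open>n0\<close>, where the
    mass bound is not yet available. The inserted 1 covers the case \<open>n0 = 0\<close>.\<close>
  define \<rho> where "\<rho> = Min (insert 1 (gap ` {..<n0}))"
  have \<rho>: "0 < \<rho>" "\<And>m. m < n0 \<Longrightarrow> \<rho> \<le> gap m"
    using gap_pos by (auto simp: \<rho>_def)
  have sub: "cf_set c 2 \<subseteq> cf_set c N"
  proof
    fix x assume x: "x \<in> cf_set c 2"
    have "real_of_int (cf_quotient (Suc n) x) < N * real (c n)" for n
    proof -
      have "real_of_int (cf_quotient (Suc n) x) < 2 * real (c n)"
        using x by (simp add: cf_set_def)
      also have "\<dots> \<le> N * real (c n)"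
        using N by (intro mult_right_mono) auto
      finally show ?thesis .
    qed
    with x show "x \<in> cf_set c N"
      by (simp add: cf_set_def)
  qed
  \<comment> \<open>The estimate needs a positive \<open>r\<close>, whereas a diameter may be 0.
    Right continuity gives an \<open>r\<close> slightly above the diameter at the price of
    \<open>\<epsilon>\<close>, and the bound \<open>\<rho> / 2\<close> leaves room for it below
    \<open>\<rho>\<close>.\<close>
  have piece: "\<exists>B\<in>sets word_measure. coded V \<subseteq> B \<and>
      emeasure word_measure B \<le> ennreal (12 powr t) * hausdorff_gauge t V + ennreal \<epsilon>"
    if V: "bounded V" "diameter V \<le> \<rho> / 2" and \<epsilon>: "0 < \<epsilon>" for V :: "real set" and \<epsilon>
  proof -
    consider "V = {}" | "V \<noteq> {}" "t = 0" | "V \<noteq> {}" "0 < t"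
      using t(1) by fastforce
    then show ?thesis
    proof cases
      case 1
      then show ?thesis
        by (intro bexI[of _ "{}"]) (auto simp: coded_def)
    next
      \<comment> \<open>For \<open>t = 0\<close> a nonempty set has gauge 1, which is the mass of
        the whole space.\<close>
      case 2
      then show ?thesis
        by (intro bexI[of _ "space word_measure"])
           (auto simp: hausdorff_gauge_def emeasure_space_1, simp add: space_PiM)
    next
      case 3
      let ?d = "diameter V"
      have d: "0 \<le> ?d" "?d < \<rho>"
        using V \<rho>(1) by (auto simp: diameter_ge_0)
      have "((\<lambda>r. (12 * r) powr t) \<longlongrightarrow> (12 * ?d) powr t) (at_right ?d)"
        using 3 d(1) by (intro tendsto_powr' tendsto_intros)
          (auto simp: eventually_at_filter intro!: always_eventually)
      then have "eventually (\<lambda>r. (12 * r) powr t < (12 * ?d) powr t + \<epsilon>) (at_right ?d)"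
        using \<epsilon> by (intro order_tendstoD(2)) auto
      moreover have "eventually (\<lambda>r. r \<in> {?d<..<\<rho>}) (at_right ?d)"
        by (rule eventually_at_right_real[OF d(2)])
      ultimately have "eventually (\<lambda>r. (12 * r) powr t < (12 * ?d) powr t + \<epsilon> \<and> r \<in> {?d<..<\<rho>}) (at_right ?d)"
        by (rule eventually_conj)
      then obtain r where r: "(12 * r) powr t < (12 * ?d) powr t + \<epsilon>" "?d < r" "r < \<rho>"
        using eventually_happens[of _ "at_right ?d"] by auto
      have "\<exists>B\<in>sets word_measure. coded V \<subseteq> B \<and> emeasure word_measure B \<le> ennreal ((12 * r) powr t)"
      proof (rule coded_subset_small_cylinder[OF _ _ _ t(1) t1 n0])
        show "\<bar>x - y\<bar> \<le> r" if "x \<in> V" "y \<in> V" for x y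
          using diameter_bounded_bound[OF V(1) that] r(2) by (simp add: dist_real_def)
        show "r < gap m" if "m < n0" for m
          using \<rho>(2)[OF that] r(3) by simp
      qed (use r d in auto)
      moreover have "ennreal ((12 * r) powr t) \<le> ennreal (12 powr t) * hausdorff_gauge t V + ennreal \<epsilon>"
      proof -
        have "ennreal ((12 * r) powr t) \<le> ennreal ((12 * ?d) powr t + \<epsilon>)"
          using r(1) by (intro ennreal_leI) simp
        also have "\<dots> = ennreal (12 powr t) * hausdorff_gauge t V + ennreal \<epsilon>"
          using 3 \<epsilon> d by (simp add: hausdorff_gauge_def powr_mult ennreal_mult ennreal_plus)
        finally show ?thesis .
      qed
      ultimately show ?thesis
        by (meson order_trans)
    qed
  qed
  have mass: "1 \<le> ennreal (12 powr t) * (\<Sum>i. hausdorff_gauge t (U i))"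
    if U: "U \<in> delta_covers (\<rho> / 2) (cf_set c N)" for U
  proof (rule ennreal_le_epsilon)
    fix e :: real assume e: "0 < e"
    \<comment> \<open>The allowances \<open>e * (1 / 2) ^ Suc i\<close> sum to
      \<open>e\<close>.\<close>
    have "\<exists>B. \<forall>i. B i \<in> sets word_measure \<and> coded (U i) \<subseteq> B i \<and> emeasure word_measure (B i) \<le>
        ennreal (12 powr t) * hausdorff_gauge t (U i) + ennreal (e * (1 / 2) ^ Suc i)"
      using piece[of "U _" "e * (1 / 2) ^ Suc _"] U e
      by (intro choice allI) (auto simp: delta_covers_def Bex_def)
    then obtain B where B: "\<And>i. B i \<in> sets word_measure" "\<And>i. coded (U i) \<subseteq> B i"
      "\<And>i. emeasure word_measure (B i) \<le>
        ennreal (12 powr t) * hausdorff_gauge t (U i) + ennreal (e * (1 / 2) ^ Suc i)"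
      by blast
    have "\<omega> \<in> (\<Union>i. B i)" if w: "\<omega> \<in> words" for \<omega>
    proof -
      obtain x where x: "x \<in> cf_set c 2" "\<forall>n. cf_quotient (Suc n) x = int (\<omega> n)"
        using ex_cf_set_point[OF w] by blast
      then obtain i where "x \<in> U i"
        using U sub by (auto simp: delta_covers_def)
      then have "\<omega> \<in> coded (U i)"
        using x w by (auto simp: coded_def)
      then show ?thesis
        using B(2) by blast
    qed
    then have "AE \<omega> in word_measure. \<omega> \<in> (\<Union>i. B i)"
      using AE_words by (auto elim: eventually_mono)
    then have "1 = emeasure word_measure (\<Union>i. B i)"
      using B(1) by (intro emeasure_eq_1_AE[symmetric]) auto
    also have "\<dots> \<le> (\<Sum>i. emeasure word_measure (B i))"
      using B(1) by (intro emeasure_subadditive_countably) auto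
    also have "\<dots> \<le> (\<Sum>i. ennreal (12 powr t) * hausdorff_gauge t (U i) + ennreal (e * (1 / 2) ^ Suc i))"
      by (intro suminf_le B(3)) auto
    also have "\<dots> = ennreal (12 powr t) * (\<Sum>i. hausdorff_gauge t (U i)) + (\<Sum>i. ennreal (e * (1 / 2) ^ Suc i))"
      by (subst suminf_add[symmetric]) (auto simp: ennreal_suminf_cmult)
    also have "(\<Sum>i. ennreal (e * (1 / 2) ^ Suc i)) = ennreal e"
      using e sums_mult[OF power_half_series, of e] by (intro suminf_ennreal_eq) auto
    finally show "1 \<le> ennreal (12 powr t) * (\<Sum>i. hausdorff_gauge t (U i)) + ennreal e" .
  qed
  have "ennreal ((1 / 12) powr t) \<le> hausdorff_premeasure t (\<rho> / 2) (cf_set c N)"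
    unfolding hausdorff_premeasure_def
  proof (rule INF_greatest)
    fix U assume "U \<in> delta_covers (\<rho> / 2) (cf_set c N)"
    from mult_left_mono[OF mass[OF this], of "ennreal ((1 / 12) powr t)"]
    show "ennreal ((1 / 12) powr t) \<le> (\<Sum>i. hausdorff_gauge t (U i))"
      by (simp add: mult.assoc[symmetric] powr_divide flip: ennreal_mult)
  qed
  also have "\<dots> \<le> hausdorff_measure t (cf_set c N)"
    unfolding hausdorff_measure_def using \<rho>(1) by (intro SUP_upper) auto
  finally show ?thesis
    by auto
qed

section \<open>The dimension formula\<close>

theorem hausdorff_dim_cf_set:
  assumes N: "2 \<le> N"
  shows "hausdorff_dim (cf_set c N) = liminf (\<lambda>n. ereal (ratio n))" (is "_ = ?L")
proof (rule antisym)
  have nn: "0 \<le> ?L"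
    by (rule Liminf_bounded) (simp add: ratio_nonneg)
  show "hausdorff_dim (cf_set c N) \<le> ?L"
  proof (rule ccontr)
    assume "\<not> ?thesis"
    then obtain t where lt: "?L < ereal t" "ereal t < hausdorff_dim (cf_set c N)"
      using ereal_dense2[of ?L "hausdorff_dim (cf_set c N)"] by (auto simp: not_le)
    \<comment> \<open>Only nonnegative exponents enter the infimum that defines the
      dimension.\<close>
    have "0 < ereal t"
      using nn lt(1) by (rule le_less_trans)
    then have "hausdorff_dim (cf_set c N) \<le> ereal t"
      unfolding hausdorff_dim_def
      using hausdorff_measure_cf_set_eq_0[OF N lt(1)] by (intro Inf_lower) auto
    with lt(2) show False
      by simp
  qed
  show "?L \<le> hausdorff_dim (cf_set c N)"
    unfolding hausdorff_dim_def
    using hausdorff_measure_cf_set_neq_0[OF N] by (intro Inf_greatest) (auto simp: not_less[symmetric])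
qed

end

theorem lemma3p2:
  fixes s :: "nat \<Rightarrow> nat" and N :: real
  assumes "filterlim s at_top sequentially"
    and "\<And>n. n \<ge> 1 \<Longrightarrow> s n \<ge> 3"
    and "N \<ge> 2"
  shows "hausdorff_dim {x::real. x \<in> {0..<1} \<and> x \<notin> \<rat> \<and>
            (\<forall>n\<ge>1. int (s n) \<le> cf_quotient n x \<and>
                    real_of_int (cf_quotient n x) < N * real (s n))}
       = liminf (\<lambda>n. ereal (ln (real (\<Prod>k=1..n. s k)) /
            (2 * ln (real (\<Prod>k=1..n. s k)) + ln (real (s (n + 1))))))"
proof -
  \<comment> \<open>Digits are numbered from 1 in the statement and from 0 in the locale. The shift
    turns \<open>s (n + 1)\<close> into \<open>?c n\<close> and the product over
    \<open>{1..n}\<close> into \<open>Q n\<close>.\<close>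
  let ?c = "\<lambda>n. s (Suc n)"
  interpret cf_digit_scale ?c
    using assms(1,2) by unfold_locales (auto simp: filterlim_sequentially_Suc)
  have shift: "(\<forall>n\<ge>1. P n) \<longleftrightarrow> (\<forall>n. P (Suc n))" for P :: "nat \<Rightarrow> bool"
    by (metis Suc_le_D One_nat_def le_add1 plus_1_eq_Suc)
  have set: "{x::real. x \<in> {0..<1} \<and> x \<notin> \<rat> \<and>
            (\<forall>n\<ge>1. int (s n) \<le> cf_quotient n x \<and>
                    real_of_int (cf_quotient n x) < N * real (s n))} = cf_set ?c N"
    unfolding shift cf_set_def by auto
  have "real (\<Prod>k=1..n. s k) = Q n" for n
    by (simp add: Q_def prod.atLeast1_atMost_eq)
  then show ?thesis
    unfolding set hausdorff_dim_cf_set[OF assms(3)] ratio_def by simp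
qed

end
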